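(* There exists a triangle $T$ such that for every $\varepsilon>0$ and for all sufficiently large $n$ there is a set $P$ of $n$ points in the plane for which the number of triangles with vertices in $P$ that are $\varepsilon$-similar to $T$ exceeds $n^3/15$.
   Context: A triangle with angles $\alpha',\beta',\gamma'$ is called $\varepsilon$-similar to a triangle $T$ with angles $\alpha,\beta,\gamma$ if, for a suitable labelling of its angles, $|\alpha-\alpha'|<\varepsilon$, $|\beta-\beta'|<\varepsilon$ and $|\gamma-\gamma'|<\varepsilon$. *)

theory Defs
  imports "HOL-Analysis.Analysis"
begin

text \<open>The first argument is the vertex of the angle.\<close>
definition angle_at :: "real^2 \<Rightarrow> real^2 \<Rightarrow> real^2 \<Rightarrow> real" where
  "angle_at a b c = arccos (((b - a) \<bullet> (c - a)) / (norm (b - a) * norm (c - a)))"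

text \<open>A triangle is represented by its vertex set. Degenerate triples are excluded.\<close>
definition is_triangle :: "(real^2) set \<Rightarrow> bool" where
  "is_triangle S \<longleftrightarrow> card S = 3 \<and> \<not> collinear S"

definition eps_similar :: "real \<Rightarrow> (real^2) set \<Rightarrow> (real^2) set \<Rightarrow> bool" where
  "eps_similar \<epsilon> S T \<longleftrightarrow> is_triangle S \<and> is_triangle T \<and>
     (\<exists>a b c a' b' c'. T = {a, b, c} \<and> S = {a', b', c'} \<and>
        \<bar>angle_at a b c - angle_at a' b' c'\<bar> < \<epsilon> \<and>
        \<bar>angle_at b c a - angle_at b' c' a'\<bar> < \<epsilon> \<and>
        \<bar>angle_at c a b - angle_at c' a' b'\<bar> < \<epsilon>)"

end

theory Submission
  imports Defs
begin

text \<open>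
  The triangle is the right isosceles one. Every three vertices of a square form such a triangle,
  and so do two adjacent vertices together with the centre; hence 8 of the 10 triples in the
  five-point configuration ``square with its centre'' are right isosceles, the other two being
  collinear.

  Since being \<open>\<epsilon>\<close>-similar to \<open>T\<close> is an open condition (\<open>eps_similar_open\<close>), any configuration \<open>R\<close>
  may be blown up: each point of \<open>R\<close> is replaced by a tiny copy of some other point set. A triple
  that picks one point from each of the three clusters of a triangle similar to \<open>T\<close> is then itself
  \<open>\<epsilon>\<close>-similar to \<open>T\<close>, and a cluster keeps its own good triples because angles survive scaling
  (\<open>blow_up\<close>). Blow up the square with its centre, putting a fraction \<open>x = 2/9\<close> of the points at each
  vertex and \<open>y = 1/9\<close> at the centre, and arrange each cluster so that it already has about \<open>c m^3\<close>
  good triples on \<open>m\<close> points. The resulting \<open>n\<close> points carry about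
  \<open>(4 x^3 + 4 x^2 y + (4 x^3 + y^3) c) n^3 = (16/243 + 11/243 c) n^3\<close> good triples, up to an error of
  order \<open>n^2\<close> (\<open>cubic_density_step\<close>). From \<open>c = 0\<close> two such steps reach
  \<open>4064/59049 = 0.0688...\<close>, which is more than \<open>1/15\<close>. (Further steps converge to \<open>2/29\<close>. The square
  alone would not do: the corresponding recursion \<open>1/16 + c/16\<close> increases to exactly \<open>1/15\<close>.)
\<close>

section \<open>Angles under scaling and perturbation\<close>

text \<open>
  Strictness in the Cauchy-Schwarz inequality is an open and scale-invariant form of
  non-degeneracy.
\<close>
lemma not_collinear_iff_inner:
  fixes a b c :: "'a::euclidean_space"
  shows "\<not> collinear {a, b, c} \<longleftrightarrow> \<bar>(b - a) \<bullet> (c - a)\<bar> < norm (b - a) * norm (c - a)"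
proof -
  have "collinear {a, b, c} \<longleftrightarrow> collinear {0, b - a, c - a}"
    using collinear_3[of b a c] by (simp add: insert_commute)
  then show ?thesis
    using norm_cauchy_schwarz_equal[of "b - a" "c - a"] Cauchy_Schwarz_ineq2[of "b - a" "c - a"]
    by linarith
qed

lemma card_not_collinear:
  fixes a b c :: "'a::euclidean_space"
  assumes "\<not> collinear {a, b, c}"
  shows "card {a, b, c} = 3"
proof -
  have "a \<noteq> b" "a \<noteq> c" "b \<noteq> c" using assms by (auto simp: insert_commute)
  then show ?thesis by simp
qed

lemma angle_at_affine:
  assumes "r > 0"
  shows "angle_at (u + r *\<^sub>R a) (u + r *\<^sub>R b) (u + r *\<^sub>R c) = angle_at a b c"
proof -
  have "(u + r *\<^sub>R x) - (u + r *\<^sub>R y) = r *\<^sub>R (x - y)" for x y :: "real^2"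
    by (simp add: algebra_simps)
  then show ?thesis using assms by (simp add: angle_at_def)
qed

lemma eps_similar_affine:
  assumes "r > 0" "eps_similar \<epsilon> S T"
  shows "eps_similar \<epsilon> ((\<lambda>x. u + r *\<^sub>R x) ` S) T"
proof -
  let ?h = "\<lambda>x. u + r *\<^sub>R x"
  obtain a b c a' b' c' where *: "T = {a, b, c}" "S = {a', b', c'}"
        "\<bar>angle_at a b c - angle_at a' b' c'\<bar> < \<epsilon>"
        "\<bar>angle_at b c a - angle_at b' c' a'\<bar> < \<epsilon>"
        "\<bar>angle_at c a b - angle_at c' a' b'\<bar> < \<epsilon>"
    and T: "is_triangle T" "is_triangle S"
    using assms(2) unfolding eps_similar_def by blast
  have "(u + r *\<^sub>R x) - (u + r *\<^sub>R y) = r *\<^sub>R (x - y)" for x y :: "real^2"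
    by (simp add: algebra_simps)
  then have "\<not> collinear {?h a', ?h b', ?h c'} \<longleftrightarrow> \<not> collinear {a', b', c'}"
    unfolding not_collinear_iff_inner using assms(1) by (simp add: abs_mult)
  then have nc: "\<not> collinear {?h a', ?h b', ?h c'}"
    using T * by (simp add: is_triangle_def)
  then have "is_triangle (?h ` S)"
    using card_not_collinear[OF nc] * by (simp add: is_triangle_def)
  moreover have "?h ` S = {?h a', ?h b', ?h c'}" using * by simp
  moreover have "\<bar>angle_at a b c - angle_at (?h a') (?h b') (?h c')\<bar> < \<epsilon>"
        "\<bar>angle_at b c a - angle_at (?h b') (?h c') (?h a')\<bar> < \<epsilon>"
        "\<bar>angle_at c a b - angle_at (?h c') (?h a') (?h b')\<bar> < \<epsilon>"
    using * assms(1) by (simp_all add: angle_at_affine)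
  ultimately show ?thesis unfolding eps_similar_def using T(1) *(1) by blast
qed

text \<open>
  Non-collinearity keeps the cosine strictly between \<open>-1\<close> and \<open>1\<close>, where \<open>arccos\<close> is continuous.
\<close>
lemma tendsto_angle_at:
  assumes "(f \<longlongrightarrow> a) F" "(g \<longlongrightarrow> b) F" "(h \<longlongrightarrow> c) F" "\<not> collinear {a, b, c}"
  shows "((\<lambda>x. angle_at (f x) (g x) (h x)) \<longlongrightarrow> angle_at a b c) F"
proof -
  let ?q = "((b - a) \<bullet> (c - a)) / (norm (b - a) * norm (c - a))"
  have ne: "b \<noteq> a" "c \<noteq> a" using assms(4) by (auto simp: insert_commute)
  then have pos: "norm (b - a) * norm (c - a) > 0" by simp
  then have "-1 < ?q" "?q < 1"
    using assms(4) unfolding not_collinear_iff_inner by (auto simp: divide_simps abs_less_iff)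
  then have "isCont arccos ?q" by (rule isCont_arccos)
  moreover have "((\<lambda>x. ((g x - f x) \<bullet> (h x - f x)) / (norm (g x - f x) * norm (h x - f x))) \<longlongrightarrow> ?q) F"
    using pos by (intro tendsto_intros assms) auto
  ultimately show ?thesis unfolding angle_at_def by (rule isCont_tendsto_compose)
qed

text \<open>
  All requirements are strict inequalities between continuous functions of the three vertices:
  the three angle conditions, and non-collinearity in the form of \<open>not_collinear_iff_inner\<close>.
  Perturbations are functions \<open>g\<close> on the vertices, which is how they arise when each vertex is
  replaced by a point of its cluster.
\<close>
lemma eps_similar_open:
  assumes "eps_similar \<epsilon> U T"
  shows "\<exists>\<eta>>0. \<forall>g. (\<forall>u\<in>U. dist (g u) u < \<eta>) \<longrightarrow> eps_similar \<epsilon> (g ` U) T"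
proof -
  obtain a b c a' b' c' where *: "T = {a, b, c}" "U = {a', b', c'}"
        "\<bar>angle_at a b c - angle_at a' b' c'\<bar> < \<epsilon>"
        "\<bar>angle_at b c a - angle_at b' c' a'\<bar> < \<epsilon>"
        "\<bar>angle_at c a b - angle_at c' a' b'\<bar> < \<epsilon>"
    and T: "is_triangle T" "is_triangle U"
    using assms unfolding eps_similar_def by blast
  have nc: "\<not> collinear {a', b', c'}" using T * by (simp add: is_triangle_def)
  have nc2: "\<not> collinear {b', c', a'}" "\<not> collinear {c', a', b'}"
    using nc by (simp_all add: insert_commute)
  let ?F = "nhds (a', b', c')"
  let ?x = "\<lambda>p::(real^2)\<times>(real^2)\<times>(real^2). fst p"
  let ?y = "\<lambda>p::(real^2)\<times>(real^2)\<times>(real^2). fst (snd p)"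
  let ?z = "\<lambda>p::(real^2)\<times>(real^2)\<times>(real^2). snd (snd p)"
  have id: "((\<lambda>p. p) \<longlongrightarrow> (a', b', c')) ?F" by (rule filterlim_ident)
  have lim: "(?x \<longlongrightarrow> a') ?F" "(?y \<longlongrightarrow> b') ?F" "(?z \<longlongrightarrow> c') ?F"
    using tendsto_fst[OF id] tendsto_fst[OF tendsto_snd[OF id]] tendsto_snd[OF tendsto_snd[OF id]]
    by simp_all
  have "((\<lambda>p. \<bar>angle_at a b c - angle_at (?x p) (?y p) (?z p)\<bar>)
            \<longlongrightarrow> \<bar>angle_at a b c - angle_at a' b' c'\<bar>) ?F"
       "((\<lambda>p. \<bar>angle_at b c a - angle_at (?y p) (?z p) (?x p)\<bar>)
            \<longlongrightarrow> \<bar>angle_at b c a - angle_at b' c' a'\<bar>) ?F"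
       "((\<lambda>p. \<bar>angle_at c a b - angle_at (?z p) (?x p) (?y p)\<bar>)
            \<longlongrightarrow> \<bar>angle_at c a b - angle_at c' a' b'\<bar>) ?F"
    by (intro tendsto_intros tendsto_angle_at lim nc nc2)+
  note this[THEN order_tendstoD(2)]
  then have ev: "\<forall>\<^sub>F p in ?F. \<bar>angle_at a b c - angle_at (?x p) (?y p) (?z p)\<bar> < \<epsilon>"
       "\<forall>\<^sub>F p in ?F. \<bar>angle_at b c a - angle_at (?y p) (?z p) (?x p)\<bar> < \<epsilon>"
       "\<forall>\<^sub>F p in ?F. \<bar>angle_at c a b - angle_at (?z p) (?x p) (?y p)\<bar> < \<epsilon>"
    using *(3-5) by blast+
  have "((\<lambda>p. norm (?y p - ?x p) * norm (?z p - ?x p) - \<bar>(?y p - ?x p) \<bullet> (?z p - ?x p)\<bar>)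
          \<longlongrightarrow> norm (b' - a') * norm (c' - a') - \<bar>(b' - a') \<bullet> (c' - a')\<bar>) ?F"
    by (intro tendsto_intros lim)
  moreover have "norm (b' - a') * norm (c' - a') - \<bar>(b' - a') \<bullet> (c' - a')\<bar> > 0"
    using nc by (simp add: not_collinear_iff_inner)
  ultimately have "\<forall>\<^sub>F p in ?F.
      norm (?y p - ?x p) * norm (?z p - ?x p) - \<bar>(?y p - ?x p) \<bullet> (?z p - ?x p)\<bar> > 0"
    by (rule order_tendstoD(1))
  then have "\<forall>\<^sub>F p in ?F. \<not> collinear {?x p, ?y p, ?z p}"
    by (simp add: not_collinear_iff_inner)
  with ev have "\<forall>\<^sub>F p in ?F. eps_similar \<epsilon> {?x p, ?y p, ?z p} T"
  proof eventually_elim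
    case (elim p)
    then have "is_triangle {?x p, ?y p, ?z p}"
      using card_not_collinear by (auto simp: is_triangle_def)
    with elim T(1) *(1) show ?case unfolding eps_similar_def by blast
  qed
  then obtain d where d: "d > 0" "\<And>p. dist p (a', b', c') < d \<Longrightarrow> eps_similar \<epsilon> {?x p, ?y p, ?z p} T"
    unfolding eventually_nhds_metric by blast
  show ?thesis
  proof (intro exI[of _ "d / 3"] conjI allI impI)
    show "d / 3 > 0" using d by simp
    fix g assume g: "\<forall>u\<in>U. dist (g u) u < d / 3"
    have "dist (g a', g b', g c') (a', b', c')
        \<le> dist (g a') a' + dist (g b', g c') (b', c')"
      unfolding dist_Pair_Pair[of "g a'"] by (rule sqrt_sum_squares_le_sum) auto
    also have "dist (g b', g c') (b', c') \<le> dist (g b') b' + dist (g c') c'"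
      unfolding dist_Pair_Pair by (rule sqrt_sum_squares_le_sum) auto
    finally have "dist (g a', g b', g c') (a', b', c') < d"
      using g *(2) by simp
    from d(2)[OF this] show "eps_similar \<epsilon> (g ` U) T" using *(2) by simp
  qed
qed

section \<open>Blowing up a configuration\<close>

definition sim_count :: "real \<Rightarrow> (real^2) set \<Rightarrow> (real^2) set \<Rightarrow> nat" where
  "sim_count \<epsilon> T P = card {S. S \<subseteq> P \<and> eps_similar \<epsilon> S T}"

lemma eps_similar_finite: "eps_similar \<epsilon> S T \<Longrightarrow> finite S \<and> card S = 3"
  by (metis card.infinite eps_similar_def is_triangle_def zero_neq_numeral)

text \<open>
  The clusters \<open>C u\<close> are copies of the \<open>Q u\<close>, shrunk so far that they are pairwise disjoint and
  that moving each vertex of a good triangle of \<open>R\<close> within its cluster keeps it good. The first sum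
  counts the triples with one point in each of three clusters, the second one the triples inside a
  single cluster.
\<close>
lemma blow_up:
  fixes R :: "(real^2) set" and Q :: "real^2 \<Rightarrow> (real^2) set"
  assumes R: "finite R" and Q: "\<And>u. u \<in> R \<Longrightarrow> finite (Q u)"
  shows "\<exists>P. finite P \<and> card P = (\<Sum>u\<in>R. card (Q u)) \<and>
      sim_count \<epsilon> T P \<ge> (\<Sum>U | U \<subseteq> R \<and> eps_similar \<epsilon> U T. \<Prod>u\<in>U. card (Q u)) +
                       (\<Sum>u\<in>R. sim_count \<epsilon> T (Q u))"
proof -
  define \<F> where "\<F> = {U. U \<subseteq> R \<and> eps_similar \<epsilon> U T}"
  have fF: "finite \<F>" unfolding \<F>_def by (rule finite_subset[of _ "Pow R"]) (auto simp: R)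
  have "\<forall>U\<in>\<F>. \<exists>\<eta>>0. \<forall>g. (\<forall>u\<in>U. dist (g u) u < \<eta>) \<longrightarrow> eps_similar \<epsilon> (g ` U) T"
    using eps_similar_open by (auto simp: \<F>_def)
  then obtain \<eta> where \<eta>: "\<And>U. U \<in> \<F> \<Longrightarrow> \<eta> U > 0"
      "\<And>U g. U \<in> \<F> \<Longrightarrow> (\<And>u. u \<in> U \<Longrightarrow> dist (g u) u < \<eta> U) \<Longrightarrow> eps_similar \<epsilon> (g ` U) T"
    by metis
  \<comment> \<open>The cluster radius is the minimum of all perturbation bounds and half the distances in \<open>R\<close>;
      the extra 1 makes the minimum meaningful when there are none.\<close>
  define M where "M = insert 1 (\<eta> ` \<F> \<union> (\<lambda>(u, v). dist u v / 2) ` {(u, v) \<in> R \<times> R. u \<noteq> v})"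
  have "finite {(u, v) \<in> R \<times> R. u \<noteq> v}" by (rule finite_subset[of _ "R \<times> R"]) (auto simp: R)
  then have fM: "finite M" unfolding M_def using fF by blast
  define d where "d = Min M"
  have d0: "d > 0" unfolding d_def using fM by (subst Min_gr_iff) (auto simp: M_def \<eta>)
  have d\<eta>: "d \<le> \<eta> U" if "U \<in> \<F>" for U
    unfolding d_def using fM that by (intro Min_le) (auto simp: M_def)
  have dR: "2 * d \<le> dist u v" if "u \<in> R" "v \<in> R" "u \<noteq> v" for u v
  proof -
    have "d \<le> dist u v / 2"
      unfolding d_def using fM that by (intro Min_le) (force simp: M_def)+
    then show ?thesis by simp
  qed
  have "bounded (\<Union>u\<in>R. Q u)" using R Q by (intro finite_imp_bounded) auto
  then obtain B where B: "B > 0" "\<And>x u. u \<in> R \<Longrightarrow> x \<in> Q u \<Longrightarrow> norm x \<le> B"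
    unfolding bounded_pos by blast
  define r where "r = d / (2 * B)"
  have r0: "r > 0" using d0 B by (simp add: r_def)
  define h where "h u x = u + r *\<^sub>R x" for u x :: "real^2"
  define C where "C u = h u ` Q u" for u
  have injh: "inj (h u)" for u unfolding h_def using r0 by (auto intro!: injI)
  have cardC: "card (C u) = card (Q u)" for u
    unfolding C_def using injh by (meson card_image inj_on_subset subset_UNIV)
  have fC: "finite (C u)" if "u \<in> R" for u using Q[OF that] by (simp add: C_def)
  have close: "dist y u < d" if uy: "u \<in> R" "y \<in> C u" for u y
  proof -
    obtain x where x: "x \<in> Q u" "y = h u x" using uy(2) by (auto simp: C_def)
    have "dist y u = r * norm x" using x r0 by (simp add: h_def dist_norm)
    also have "\<dots> \<le> r * B" using B(2)[OF uy(1) x(1)] r0 by simp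
    also have "\<dots> < d" using B d0 by (simp add: r_def)
    finally show ?thesis .
  qed
  have disj: "u = v" if "u \<in> R" "v \<in> R" "y \<in> C u" "y \<in> C v" for u v y
    using dR[of u v] close[of u y] close[of v y] that dist_triangle2[of u v y]
    by (force simp: dist_commute)
  define P where "P = (\<Union>u\<in>R. C u)"
  have fP: "finite P" unfolding P_def using R fC by auto
  have cP: "card P = (\<Sum>u\<in>R. card (Q u))"
    unfolding P_def using R fC disj by (subst card_UN_disjoint) (auto simp: cardC)
  \<comment> \<open>\<open>X\<close> collects the triples spread over three clusters, as images of choice functions;
      \<open>Y u\<close> those inside the cluster of \<open>u\<close>.\<close>
  define X where "X = (\<lambda>(U, g). g ` U) ` (SIGMA U:\<F>. PiE U C)"
  define Y where "Y u = {S. S \<subseteq> C u \<and> eps_similar \<epsilon> S T}" for u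
  have UR: "U \<subseteq> R" if "U \<in> \<F>" for U using that by (simp add: \<F>_def)
  have fU: "finite U" if "U \<in> \<F>" for U using UR[OF that] R finite_subset by blast
  have val: "g u = y" if gy: "U \<in> \<F>" "g \<in> PiE U C" "y \<in> g ` U" "y \<in> C u" "u \<in> R" for U g y u
  proof -
    obtain v where "v \<in> U" "y = g v" using gy(3) by auto
    moreover have "g v \<in> C v" using gy(2) \<open>v \<in> U\<close> by auto
    ultimately show ?thesis using disj[of u v y] gy UR by blast
  qed
  have rec: "U = {u \<in> R. g ` U \<inter> C u \<noteq> {}}" if "U \<in> \<F>" "g \<in> PiE U C" for U g
    using that UR[OF that(1)] disj by (fastforce simp: PiE_def Pi_def)
  \<comment> \<open>By disjointness of the clusters, a triple determines the clusters it meets and the point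
      chosen in each, so counting choice functions counts triples.\<close>
  have "inj_on (\<lambda>(U, g). g ` U) (SIGMA U:\<F>. PiE U C)"
  proof (rule inj_onI, clarify)
    fix U g V k assume A: "U \<in> \<F>" "g \<in> PiE U C" "V \<in> \<F>" "k \<in> PiE V C" "g ` U = k ` V"
    have "U = V" using rec[OF A(1,2)] rec[OF A(3,4)] A(5) by simp
    moreover have "g = k"
    proof (rule PiE_ext[OF A(2)])
      show "k \<in> PiE U C" using A \<open>U = V\<close> by simp
      fix u assume u: "u \<in> U"
      then have "g u \<in> k ` V" "g u \<in> C u" "u \<in> R" using A UR[OF A(1)] by auto
      then show "g u = k u" using val[OF A(3,4)] by metis
    qed
    ultimately show "U = V \<and> g = k" by simp
  qed
  then have "card X = card (SIGMA U:\<F>. PiE U C)" unfolding X_def by (rule card_image)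
  also have "\<dots> = (\<Sum>U\<in>\<F>. card (PiE U C))"
    using fF fU UR fC by (subst card_SigmaI) (auto intro!: finite_PiE)
  also have "\<dots> = (\<Sum>U\<in>\<F>. \<Prod>u\<in>U. card (Q u))"
    using fU by (intro sum.cong) (auto simp: card_PiE cardC)
  finally have cX: "card X = (\<Sum>U\<in>\<F>. \<Prod>u\<in>U. card (Q u))" .
  have cY: "card (Y u) \<ge> sim_count \<epsilon> T (Q u)" if "u \<in> R" for u
  proof -
    have "inj_on (image (h u)) A" for A
      using injh[of u] by (auto intro!: inj_onI simp: inj_image_eq_iff)
    moreover have "image (h u) ` {S. S \<subseteq> Q u \<and> eps_similar \<epsilon> S T} \<subseteq> Y u"
      unfolding Y_def C_def using eps_similar_affine[OF r0] by (auto simp: h_def[abs_def])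
    moreover have "finite (Y u)"
      unfolding Y_def by (rule finite_subset[of _ "Pow (C u)"]) (auto simp: fC that)
    ultimately show ?thesis unfolding sim_count_def by (metis card_inj_on_le)
  qed
  have fY: "finite (Y u)" if "u \<in> R" for u
    unfolding Y_def by (rule finite_subset[of _ "Pow (C u)"]) (auto simp: fC that)
  have fX: "finite X"
    unfolding X_def using fF fU UR fC by (intro finite_imageI finite_SigmaI finite_PiE) blast+
  have XP: "X \<subseteq> {S. S \<subseteq> P \<and> eps_similar \<epsilon> S T}"
  proof clarsimp
    fix S assume "S \<in> X"
    then obtain U g where S: "U \<in> \<F>" "g \<in> PiE U C" "S = g ` U" unfolding X_def by auto
    have gC: "g u \<in> C u" "u \<in> R" if "u \<in> U" for u using S that UR by auto
    have "eps_similar \<epsilon> (g ` U) T"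
      using close gC d\<eta>[OF S(1)] by (intro \<eta>(2)[OF S(1)]) fastforce
    then show "S \<subseteq> P \<and> eps_similar \<epsilon> S T" using gC S by (auto simp: P_def)
  qed
  have YP: "Y u \<subseteq> {S. S \<subseteq> P \<and> eps_similar \<epsilon> S T}" if "u \<in> R" for u
    using that by (auto simp: Y_def P_def)
  have XY: "X \<inter> (\<Union>u\<in>R. Y u) = {}"
  proof (rule ccontr)
    assume "X \<inter> (\<Union>u\<in>R. Y u) \<noteq> {}"
    then obtain S u where S: "S \<in> X" "u \<in> R" "S \<in> Y u" by blast
    then obtain U g where g: "U \<in> \<F>" "g \<in> PiE U C" "S = g ` U" unfolding X_def by auto
    have "S \<subseteq> {g u}"
    proof
      fix y assume y: "y \<in> S"
      then have "y \<in> C u" using S(3) by (auto simp: Y_def)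
      then show "y \<in> {g u}" using val[OF g(1,2), of y u] y g(3) S(2) by simp
    qed
    then have "card S \<le> card {g u}" by (rule card_mono[rotated]) simp
    then show False using eps_similar_finite[of \<epsilon> S T] S(3) by (simp add: Y_def)
  qed
  have YY: "Y u \<inter> Y v = {}" if "u \<in> R" "v \<in> R" "u \<noteq> v" for u v
  proof (rule ccontr)
    assume "Y u \<inter> Y v \<noteq> {}"
    then obtain S where S: "S \<subseteq> C u" "S \<subseteq> C v" "eps_similar \<epsilon> S T" by (auto simp: Y_def)
    then have "S \<noteq> {}" using eps_similar_finite by fastforce
    then show False using S disj that by blast
  qed
  have "card X + (\<Sum>u\<in>R. card (Y u)) = card X + card (\<Union>u\<in>R. Y u)"
    using R fY YY by (subst card_UN_disjoint) auto
  also have "\<dots> = card (X \<union> (\<Union>u\<in>R. Y u))"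
    using fX fY R XY by (subst card_Un_disjoint) auto
  also have "\<dots> \<le> sim_count \<epsilon> T P"
    unfolding sim_count_def using XP YP fP by (intro card_mono) auto
  finally have "sim_count \<epsilon> T P \<ge> card X + (\<Sum>u\<in>R. card (Y u))" .
  moreover have "(\<Sum>u\<in>R. card (Y u)) \<ge> (\<Sum>u\<in>R. sim_count \<epsilon> T (Q u))"
    using cY by (rule sum_mono)
  ultimately show ?thesis
    using fP cP cX unfolding \<F>_def by (intro exI[of _ P]) linarith
qed

section \<open>The square with its centre\<close>

definition right_isosceles :: "real^2 \<Rightarrow> real^2 \<Rightarrow> real^2 \<Rightarrow> bool" where
  "right_isosceles p q r \<longleftrightarrow> q \<noteq> p \<and> (q - p) \<bullet> (r - p) = 0 \<and> norm (r - p) = norm (q - p)"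

lemma right_isosceles_angles:
  assumes "right_isosceles p q r"
  shows "angle_at p q r = pi / 2" "angle_at q r p = arccos (1 / sqrt 2)"
    "angle_at r p q = arccos (1 / sqrt 2)" "is_triangle {p, q, r}"
proof -
  define x y where "x = q - p" and "y = r - p"
  have xy: "x \<bullet> y = 0" "norm y = norm x" "norm x > 0"
    using assms by (auto simp: right_isosceles_def x_def y_def)
  have n2: "x \<bullet> x = (norm x)^2" "y \<bullet> y = (norm x)^2"
    using xy(2) power2_norm_eq_inner[of x] power2_norm_eq_inner[of y] by simp_all
  have yx: "y \<bullet> x = 0" using xy(1) by (simp add: inner_commute)
  have "(norm (x - y))^2 = (sqrt 2 * norm x)^2"
    by (simp add: power2_norm_eq_inner[of "x - y"] inner_diff xy(1) yx n2 power_mult_distrib)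
  then have d: "norm (x - y) = sqrt 2 * norm x"
    by (rule power2_eq_imp_eq) simp_all
  have rq: "r - q = y - x" "p - q = - x" "q - r = x - y" "p - r = - y" by (simp_all add: x_def y_def)
  have d': "norm (y - x) = sqrt 2 * norm x" using d by (simp add: norm_minus_commute)
  show "angle_at p q r = pi / 2"
    unfolding angle_at_def using xy by (simp flip: x_def y_def)
  show "angle_at q r p = arccos (1 / sqrt 2)"
    unfolding angle_at_def rq using xy d'
    by (simp add: inner_diff yx n2 power2_eq_square)
  show "angle_at r p q = arccos (1 / sqrt 2)"
    unfolding angle_at_def rq using xy d
    by (simp add: inner_diff yx n2 power2_eq_square)
  have nc: "\<not> collinear {p, q, r}"
    unfolding not_collinear_iff_inner using xy by (simp flip: x_def y_def)
  then show "is_triangle {p, q, r}" using card_not_collinear[OF nc] by (simp add: is_triangle_def)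
qed

lemma right_isosceles_eps_similar:
  assumes "right_isosceles p q r" "right_isosceles p' q' r'" "\<epsilon> > 0"
  shows "eps_similar \<epsilon> {p, q, r} {p', q', r'}"
proof -
  note A = right_isosceles_angles[OF assms(1)] and A' = right_isosceles_angles[OF assms(2)]
  have "\<bar>angle_at p' q' r' - angle_at p q r\<bar> < \<epsilon>"
       "\<bar>angle_at q' r' p' - angle_at q r p\<bar> < \<epsilon>"
       "\<bar>angle_at r' p' q' - angle_at r p q\<bar> < \<epsilon>"
    using assms(3) by (simp_all only: A A' diff_self abs_zero)
  then show ?thesis unfolding eps_similar_def using A(4) A'(4) by blast
qed

text \<open>
  In cyclic order \<open>a, b, c, d\<close> are the vertices of the square and \<open>z\<close> is the centre. Keeping the
  points abstract reduces the distinctness of the eight triples to distinctness of letters.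
\<close>
lemma square_centre_sum:
  fixes w :: "'a \<Rightarrow> nat"
  assumes "distinct [z, a, b, c, d]" "w z = n" "w a = m" "w b = m" "w c = m" "w d = m"
  shows "(\<Sum>U\<in>{{z, a, b}, {z, b, c}, {z, c, d}, {z, d, a}, {a, b, c}, {b, c, d}, {c, d, a}, {d, a, b}}.
     \<Prod>u\<in>U. w u) = 4 * m ^ 3 + 4 * m ^ 2 * n"
proof -
  have ne: "z \<noteq> a" "z \<noteq> b" "z \<noteq> c" "z \<noteq> d" "a \<noteq> b" "a \<noteq> c" "a \<noteq> d" "b \<noteq> c" "b \<noteq> d" "c \<noteq> d"
    using assms(1) by simp_all
  note ne' = ne ne[symmetric]
  let ?l = "[{z, a, b}, {z, b, c}, {z, c, d}, {z, d, a}, {a, b, c}, {b, c, d}, {c, d, a}, {d, a, b}]"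
  have eq: "A = B \<longleftrightarrow> A \<subseteq> B \<and> B \<subseteq> A" for A B :: "'a set" by (rule set_eq_subset)
  have "distinct ?l"
    by (simp add: eq ne')
  then have "(\<Sum>U\<in>set ?l. \<Prod>u\<in>U. w u) = sum_list (map (\<lambda>U. \<Prod>u\<in>U. w u) ?l)"
    by (rule sum.distinct_set_conv_list)
  also have "\<dots> = 4 * m ^ 3 + 4 * m ^ 2 * n"
    by (simp add: ne' assms(2-) power3_eq_cube power2_eq_square)
  finally show ?thesis by (simp only: list.set)
qed

text \<open>The copies of \<open>A\<close> sit at the four vertices, the copy of \<open>B\<close> at the centre.\<close>
lemma square_centre_blow_up:
  assumes T: "right_isosceles p q r" and \<epsilon>: "\<epsilon> > 0"
    and fin: "finite A" "finite B"
  shows "\<exists>P. finite P \<and> card P = 4 * card A + card B \<and>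
      sim_count \<epsilon> {p, q, r} P \<ge> 4 * card A ^ 3 + 4 * card A ^ 2 * card B +
                       4 * sim_count \<epsilon> {p, q, r} A + sim_count \<epsilon> {p, q, r} B"
proof -
  let ?T = "{p, q, r}"
  define x y :: "real^2" where "x = axis 1 1" and "y = axis 2 1"
  have xy: "x \<bullet> x = 1" "y \<bullet> y = 1" "x \<bullet> y = 0" "y \<bullet> x = 0"
    by (simp_all add: x_def y_def inner_axis_axis)
  have nz: "x \<noteq> 0" "y \<noteq> 0" using xy by auto
  have "x \<noteq> y" using xy by auto
  moreover have "x \<noteq> - y"
    using xy by auto
  moreover have "x \<noteq> - x" "y \<noteq> - y" "y \<noteq> - x" using nz \<open>x \<noteq> - y\<close>
    by (auto simp: eq_neg_iff_add_eq_0 add.commute simp flip: scaleR_2)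
  ultimately have ne: "distinct [0, x, y, - x, - y]" using nz by auto
  define R where "R = {0, x, y, - x, - y}"
  define Q where "Q = (\<lambda>u::real^2. if u = 0 then B else A)"
  define \<F> where "\<F> = {{0, x, y}, {0, y, - x}, {0, - x, - y}, {0, - y, x},
      {x, y, - x}, {y, - x, - y}, {- x, - y, x}, {- y, x, y}}"
  have ri: "right_isosceles 0 x y" "right_isosceles 0 y (- x)"
      "right_isosceles 0 (- x) (- y)" "right_isosceles 0 (- y) x"
      "right_isosceles y x (- x)" "right_isosceles (- x) y (- y)"
      "right_isosceles (- y) (- x) x" "right_isosceles x (- y) y"
    using ne xy by (auto simp: right_isosceles_def norm_eq_sqrt_inner inner_simps)
  have "\<forall>U\<in>\<F>. U \<subseteq> R" by (simp add: \<F>_def R_def)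
  moreover have "\<forall>U\<in>\<F>. eps_similar \<epsilon> U ?T"
  proof -
    \<comment> \<open>Put the vertex with the right angle first.\<close>
    have perm: "{x, y, - x} = {y, x, - x}" "{y, - x, - y} = {- x, y, - y}"
        "{- x, - y, x} = {- y, - x, x}" "{- y, x, y} = {x, - y, y}" by auto
    show ?thesis
      unfolding \<F>_def perm ball_simps
      using ri[THEN right_isosceles_eps_similar, OF T \<epsilon>] by (intro conjI TrueI)
  qed
  ultimately have sub: "\<F> \<subseteq> {U. U \<subseteq> R \<and> eps_similar \<epsilon> U ?T}" by blast
  have fR: "finite R" by (simp add: R_def)
  then have "finite {U. U \<subseteq> R \<and> eps_similar \<epsilon> U ?T}" by simp
  then have "(\<Sum>U\<in>\<F>. \<Prod>u\<in>U. card (Q u)) \<le>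
      (\<Sum>U | U \<subseteq> R \<and> eps_similar \<epsilon> U ?T. \<Prod>u\<in>U. card (Q u))"
    using sub by (rule sum_mono2) simp
  moreover have "(\<Sum>U\<in>\<F>. \<Prod>u\<in>U. card (Q u)) = 4 * card A ^ 3 + 4 * card A ^ 2 * card B"
    unfolding \<F>_def by (rule square_centre_sum[OF ne]) (use nz in \<open>simp_all add: Q_def\<close>)
  moreover have "(\<Sum>u\<in>R. card (Q u)) = 4 * card A + card B"
      "(\<Sum>u\<in>R. sim_count \<epsilon> ?T (Q u)) = 4 * sim_count \<epsilon> ?T A + sim_count \<epsilon> ?T B"
    using ne by (simp_all add: R_def Q_def)
  moreover have "finite (Q u)" for u using fin by (simp add: Q_def)
  ultimately show ?thesis using blow_up[OF fR, of Q \<epsilon> ?T] by fastforce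
qed

section \<open>Iterating the construction\<close>

text \<open>
  The quadratic error term makes the bound hold for every \<open>n\<close>. Clusters that happen to be small
  therefore need no separate treatment in the recursion.
\<close>
definition cubic_density :: "(real^2) set \<Rightarrow> real \<Rightarrow> bool" where
  "cubic_density T c \<longleftrightarrow> (\<forall>\<epsilon>>0. \<exists>K\<ge>0. \<forall>n. \<exists>P. finite P \<and> card P = n \<and>
     real (sim_count \<epsilon> T P) \<ge> c * real n ^ 3 - K * real n ^ 2)"

lemma cubic_density_0: "cubic_density T 0"
  unfolding cubic_density_def
proof (intro allI impI)
  fix \<epsilon> :: real
  have "\<exists>P :: (real^2) set. finite P \<and> card P = n" for n
    using infinite_arbitrarily_large[of "UNIV :: (real^2) set" n] infinite_UNIV_char_0 by blast
  then show "\<exists>K\<ge>0. \<forall>n. \<exists>P. finite P \<and> card P = n \<and>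
      real (sim_count \<epsilon> T P) \<ge> 0 * real n ^ 3 - K * real n ^ 2"
    by (intro exI[of _ 0]) auto
qed

text \<open>The loss from rounding cluster sizes down is one order below the main term.\<close>
lemma power_lower_bounds:
  fixes x s :: real
  assumes "x \<ge> 0" "s \<ge> 0" "s \<ge> x - 1"
  shows "s ^ 2 \<ge> x ^ 2 - 2 * x" "s ^ 3 \<ge> x ^ 3 - 3 * x ^ 2"
proof -
  have "s ^ 2 \<ge> x ^ 2 - 2 * x \<and> s ^ 3 \<ge> x ^ 3 - 3 * x ^ 2"
  proof (cases "x \<ge> 1")
    case True
    then have "(x - 1) ^ 2 \<le> s ^ 2" "(x - 1) ^ 3 \<le> s ^ 3" using assms by (auto intro!: power_mono)
    moreover have "(x - 1) ^ 2 = x ^ 2 - 2 * x + 1" "(x - 1) ^ 3 = x ^ 3 - 3 * x ^ 2 + 3 * x - 1"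
      by (simp_all add: power2_eq_square power3_eq_cube algebra_simps)
    ultimately show ?thesis using True by linarith
  next
    case False
    then have "x * x \<le> x * 1" "x ^ 2 * x \<le> x ^ 2 * 1"
      using assms by (intro mult_left_mono; simp)+
    moreover have "s ^ 2 \<ge> 0" "s ^ 3 \<ge> 0" "x ^ 2 \<ge> 0" using assms by simp_all
    moreover have "x ^ 2 = x * x" "x ^ 3 = x ^ 2 * x"
      by (simp_all add: power2_eq_square power3_eq_cube)
    ultimately show ?thesis using assms(1) by linarith
  qed
  then show "s ^ 2 \<ge> x ^ 2 - 2 * x" "s ^ 3 \<ge> x ^ 3 - 3 * x ^ 2" by simp_all
qed

text \<open>
  The weights \<open>x = 2/9\<close>, \<open>y = 1/9\<close> maximise the contribution \<open>4 x^2 (x + y)\<close> of the triples spread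
  over three clusters, subject to \<open>4 x + y = 1\<close>.
\<close>
lemma cubic_density_step:
  assumes T: "right_isosceles p q r" and c: "cubic_density {p, q, r} c" "c \<ge> 0"
  shows "cubic_density {p, q, r} (16 / 243 + 11 / 243 * c)"
  unfolding cubic_density_def
proof (intro allI impI)
  fix \<epsilon> :: real assume \<epsilon>: "\<epsilon> > 0"
  let ?T = "{p, q, r}"
  obtain K where K: "K \<ge> 0" "\<And>n. \<exists>P. finite P \<and> card P = n \<and>
     real (sim_count \<epsilon> ?T P) \<ge> c * real n ^ 3 - K * real n ^ 2"
    using c(1) \<epsilon> unfolding cubic_density_def by metis
  show "\<exists>K\<ge>0. \<forall>n. \<exists>P. finite P \<and> card P = n \<and>
     real (sim_count \<epsilon> ?T P) \<ge> (16 / 243 + 11 / 243 * c) * real n ^ 3 - K * real n ^ 2"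
  proof (intro exI[of _ "1 + c + 5 * K"] conjI allI)
    show "1 + c + 5 * K \<ge> 0" using K c by simp
    fix n :: nat
    define a where "a = 2 * n div 9"
    define b where "b = n - 4 * a"
    have nab: "n = 4 * a + b" "9 * a \<le> 2 * n" "2 * n \<le> 9 * a + 8" by (auto simp: a_def b_def)
    obtain A where A: "finite A" "card A = a"
        "real (sim_count \<epsilon> ?T A) \<ge> c * real a ^ 3 - K * real a ^ 2" using K(2) by blast
    obtain B where B: "finite B" "card B = b"
        "real (sim_count \<epsilon> ?T B) \<ge> c * real b ^ 3 - K * real b ^ 2" using K(2) by blast
    obtain P where P: "finite P" "card P = n"
      "sim_count \<epsilon> ?T P \<ge> 4 * a ^ 3 + 4 * a ^ 2 * b + 4 * sim_count \<epsilon> ?T A + sim_count \<epsilon> ?T B"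
      using square_centre_blow_up[OF T \<epsilon> A(1) B(1)] A(2) B(2) nab by auto
    define u s t where "u = real n" and "s = real a" and "t = real b"
    have st: "u = 4 * s + t" "9 * s \<le> 2 * u" "2 * u \<le> 9 * s + 8" "s \<ge> 0" "t \<ge> 0" "u \<ge> 0"
    proof -
      have "real n = real (4 * a + b)" "real (9 * a) \<le> real (2 * n)" "real (2 * n) \<le> real (9 * a + 8)"
        using nab by (simp_all only: of_nat_le_iff)
      then show "u = 4 * s + t" "9 * s \<le> 2 * u" "2 * u \<le> 9 * s + 8"
        unfolding u_def s_def t_def by simp_all
    qed (simp_all add: u_def s_def t_def)
    have "s \<ge> 2 / 9 * u - 1" using st(3) by linarith
    note s23 = power_lower_bounds[OF _ st(4) this]
    have pow: "(2 / 9 * u) ^ 2 = 4 / 81 * u ^ 2" "(2 / 9 * u) ^ 3 = 8 / 729 * u ^ 3"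
        "(u / 9) ^ 3 = u ^ 3 / 729"
      by (simp_all add: power2_eq_square power3_eq_cube)
    have s2: "s ^ 2 \<ge> 4 / 81 * u ^ 2 - 4 / 9 * u"
      using s23(1) st(6) unfolding pow by simp
    have s3: "s ^ 3 \<ge> 8 / 729 * u ^ 3 - 4 / 27 * u ^ 2"
      using s23(2) st(6) unfolding pow by simp
    have t3: "t ^ 3 \<ge> u ^ 3 / 729"
      unfolding pow(3)[symmetric] using st by (intro power_mono) auto
    have "4 * s^2 * (s + t) \<ge> 4 * s^2 * (u / 3)"
      using st by (intro mult_left_mono) auto
    moreover have "4 * s^2 * (u / 3) \<ge> (4 * (4 / 81 * u ^ 2 - 4 / 9 * u)) * (u / 3)"
    proof (rule mult_right_mono)
      show "4 * s^2 \<ge> 4 * (4 / 81 * u ^ 2 - 4 / 9 * u)" 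
        using mult_left_mono[OF s2, of 4] by simp
    qed (use st in simp)
    moreover have "(4 * (4 / 81 * u ^ 2 - 4 / 9 * u)) * (u / 3) = 16 / 243 * u ^ 3 - 16 / 27 * u^2"
        "4 * s^2 * (s + t) = 4 * s^3 + 4 * s^2 * t" "u^2 \<ge> 0"
      by (simp_all add: power2_eq_square power3_eq_cube field_simps)
    ultimately have main: "4 * s^3 + 4 * s^2 * t \<ge> 16 / 243 * u ^ 3 - u^2"
      by linarith
    have "s ^ 2 \<le> u ^ 2" "t ^ 2 \<le> u ^ 2" using st by (auto intro!: power_mono)
    then have "4 * (K * s ^ 2) + K * t ^ 2 \<le> 5 * K * u ^ 2" 
      using mult_left_mono[of "4 * s^2 + t^2" "5 * u^2" K] K(1) by (simp add: algebra_simps)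
    moreover have "c * (4 * s ^ 3 + t ^ 3) \<ge> c * (11 / 243 * u ^ 3 - u ^ 2)"
    proof (rule mult_left_mono)
      have "u ^ 2 \<ge> 0" by simp
      then show "4 * s ^ 3 + t ^ 3 \<ge> 11 / 243 * u ^ 3 - u ^ 2" using s3 t3 by linarith
    qed (rule c(2))
    moreover have "real (sim_count \<epsilon> ?T P) \<ge>
        4 * s ^ 3 + 4 * s ^ 2 * t + 4 * (c * s ^ 3 - K * s ^ 2) + (c * t ^ 3 - K * t ^ 2)"
    proof -
      have "real (sim_count \<epsilon> ?T P) \<ge> real (4 * a ^ 3 + 4 * a ^ 2 * b + 4 * sim_count \<epsilon> ?T A + sim_count \<epsilon> ?T B)"
        using P(3) of_nat_le_iff by blast
      then show ?thesis using A(3) B(3) unfolding s_def t_def by simp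
    qed
    ultimately have "real (sim_count \<epsilon> ?T P) \<ge>
       (16 / 243 + 11 / 243 * c) * u ^ 3 - (1 + c + 5 * K) * u ^ 2"
      using main by (simp add: algebra_simps)
    then show "\<exists>P. finite P \<and> card P = n \<and>
     real (sim_count \<epsilon> ?T P) \<ge> (16 / 243 + 11 / 243 * c) * real n ^ 3 - (1 + c + 5 * K) * real n ^ 2"
      using P unfolding u_def by blast
  qed
qed

theorem mainTheorem5:
  shows "\<exists>T :: (real^2) set. is_triangle T \<and>
    (\<forall>\<epsilon>>0. \<exists>N. \<forall>n\<ge>N. \<exists>P :: (real^2) set. finite P \<and> card P = n \<and>
       real (card {S. S \<subseteq> P \<and> is_triangle S \<and> eps_similar \<epsilon> S T}) > real n ^ 3 / 15)"
proof -
  define T :: "(real^2) set" where "T = {0, axis 1 1, axis 2 1}"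
  have ri: "right_isosceles 0 (axis 1 1) (axis 2 1)"
    by (simp add: right_isosceles_def inner_axis_axis axis_eq_0_iff)
  then have tri: "is_triangle T" unfolding T_def by (rule right_isosceles_angles)
  have "cubic_density T (16 / 243 + 11 / 243 * (16 / 243 + 11 / 243 * 0))"
    unfolding T_def by (intro cubic_density_step[OF ri] cubic_density_0) simp_all
  then have dens: "cubic_density T (4064 / 59049)" by simp
  show ?thesis
  proof (intro exI[of _ T] conjI tri allI impI)
    fix \<epsilon> :: real assume "\<epsilon> > 0"
    then obtain K where K: "\<And>n. \<exists>P. finite P \<and> card P = n \<and>
       real (sim_count \<epsilon> T P) \<ge> 4064 / 59049 * real n ^ 3 - K * real n ^ 2"
      using dens unfolding cubic_density_def by blast
    \<comment> \<open>The gap \<open>4064/59049 - 1/15\<close> exceeds \<open>1/1000\<close>.\<close>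
    obtain N :: nat where N: "real N > 1000 * K" using reals_Archimedean2 by blast
    show "\<exists>N. \<forall>n\<ge>N. \<exists>P. finite P \<and> card P = n \<and>
       real (card {S. S \<subseteq> P \<and> is_triangle S \<and> eps_similar \<epsilon> S T}) > real n ^ 3 / 15"
    proof (intro exI[of _ "Suc N"] allI impI)
      fix n assume n: "Suc N \<le> n"
      obtain P where P: "finite P" "card P = n"
        "real (sim_count \<epsilon> T P) \<ge> 4064 / 59049 * real n ^ 3 - K * real n ^ 2" using K by blast
      have "1000 * K < real n" "real n > 0" using n N by linarith+
      then have "1000 * K * real n ^ 2 < real n * real n ^ 2"
        by (intro mult_strict_right_mono) auto
      moreover have "real n * real n ^ 2 = real n ^ 3" by (simp add: power2_eq_square power3_eq_cube)
      moreover have "real n ^ 3 > 0" using \<open>real n > 0\<close> by simp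
      ultimately have "real n ^ 3 / 15 < real (sim_count \<epsilon> T P)" using P(3) by linarith
      moreover have "{S. S \<subseteq> P \<and> is_triangle S \<and> eps_similar \<epsilon> S T} = {S. S \<subseteq> P \<and> eps_similar \<epsilon> S T}"
        by (auto simp: eps_similar_def)
      ultimately show "\<exists>P. finite P \<and> card P = n \<and>
         real (card {S. S \<subseteq> P \<and> is_triangle S \<and> eps_similar \<epsilon> S T}) > real n ^ 3 / 15"
        using P unfolding sim_count_def by auto
    qed
  qed
qed

end
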